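(* For every $k\ge 2$ there exists a constant $c_k>0$ such that for any connected graph $G$ on $n$ vertices we have $P(G,k)\ge c_k\log^{k-1}n$. Moreover, if $n=4\cdot 3^{\ell}+\sum_{i=0}^{\ell}3^i$ for some $\ell\ge 1$, then for any tree $T$ on $n$ vertices we have $P(T,2)\ge P(T(\ell),2)$.
   Context: Graphs are finite and simple, and $e(G)$ denotes the number of edges of $G$. Here $k$ and $\ell$ are integers, and $\log^{k-1}n$ means $(\log n)^{k-1}$. For a graph $G$, a connected $(m_1,\dots,m_k)$-edge partition, where $\sum_{i=1}^k m_i=e(G)$, is a partition $E(G)=E_1\cup\dots\cup E_k$ with $|E_i|=m_i$ for all $i$ such that every $E_i$ forms a connected graph on the vertex set $\bigcup_{e\in E_i}e$ (the set of endpoints of the edges in $E_i$). For a connected graph $G$ and an integer $k\ge 2$, $P(G,k)$ is the number of integer $k$-tuples $(m_1,\dots,m_k)$ with $m_1\ge m_2\ge\dots\ge m_k\ge 1$ for which there exists a connected $(m_1,\dots,m_k)$-edge partition of $G$. $T(\ell)$ denotes the tree on $4\cdot 3^{\ell}+\sum_{i=0}^{\ell}3^i$ vertices obtained from the complete ternary tree of height $\ell$ (the rooted tree in which every vertex at distance less than $\ell$ from the root has exactly 3 children and the vertices at distance $\ell$ are leaves) by identifying each leaf with the middle vertex of its own new path on 5 vertices.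
   Formalization: The bound P(G,k) ≥ c_k log^{k-1} n is stated for connected graphs G with at least k edges; without this it fails (for k=2 and G a single edge, P(G,2)=0 while log 2>0), and the only other case left out, n=1, reads 0 ≥ 0. *)

theory Defs
  imports Complex_Main
begin

type_synonym 'a ugraph = "'a set \<times> 'a set set"

abbreviation verts :: "'a ugraph \<Rightarrow> 'a set" where "verts \<equiv> fst"
abbreviation edges :: "'a ugraph \<Rightarrow> 'a set set" where "edges \<equiv> snd"

definition simple_graph :: "'a ugraph \<Rightarrow> bool" where
  "simple_graph G \<longleftrightarrow> finite (verts G) \<and> (\<forall>e \<in> edges G. e \<subseteq> verts G \<and> card e = 2)"

definition connected_graph :: "'a ugraph \<Rightarrow> bool" where
  "connected_graph G \<longleftrightarrow> simple_graph G \<and> verts G \<noteq> {} \<and>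
     (\<forall>u \<in> verts G. \<forall>v \<in> verts G. (u, v) \<in> {(x, y). {x, y} \<in> edges G}\<^sup>*)"

text \<open>A cycle is given by the list of its vertices in cyclic order, without repeating the first.\<close>

definition is_cycle :: "'a ugraph \<Rightarrow> 'a list \<Rightarrow> bool" where
  "is_cycle G p \<longleftrightarrow> length p \<ge> 3 \<and> distinct p \<and>
     (\<forall>i < length p. {p ! i, p ! (Suc i mod length p)} \<in> edges G)"

definition is_tree :: "'a ugraph \<Rightarrow> bool" where
  "is_tree G \<longleftrightarrow> connected_graph G \<and> (\<nexists>p. is_cycle G p)"

definition connected_edge_partition :: "'a ugraph \<Rightarrow> nat list \<Rightarrow> 'a set set list \<Rightarrow> bool" where
  "connected_edge_partition G ms Es \<longleftrightarrow>
     sum_list ms = card (edges G) \<and>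
     length Es = length ms \<and>
     \<Union> (set Es) = edges G \<and>
     (\<forall>i < length Es. \<forall>j < length Es. i \<noteq> j \<longrightarrow> Es ! i \<inter> Es ! j = {}) \<and>
     (\<forall>i < length Es. card (Es ! i) = ms ! i \<and> connected_graph (\<Union> (Es ! i), Es ! i))"

definition num_edge_partitions :: "'a ugraph \<Rightarrow> nat \<Rightarrow> nat" where
  "num_edge_partitions G k = card {ms :: nat list.
     length ms = k \<and> sorted_wrt (\<ge>) ms \<and> (\<forall>m \<in> set ms. m \<ge> 1) \<and>
     (\<exists>Es. connected_edge_partition G ms Es)}"

text \<open>
  A vertex of the complete ternary tree of height \<open>l\<close> is a word over \<open>{0, 1, 2}\<close> of length at
  most \<open>l\<close>; the root is the empty word and the children of \<open>w\<close> are the words \<open>i # w\<close>.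
\<close>

definition ternary_words :: "nat \<Rightarrow> nat list set" where
  "ternary_words m = {w. length w = m \<and> set w \<subseteq> {0, 1, 2}}"

text \<open>
  The path glued to the leaf \<open>w\<close> is \<open>(w, 0), \<dots>, (w, 4)\<close>. Every word \<open>w\<close> is represented by
  \<open>(w, 2)\<close>, so that a leaf is the middle vertex of its path.
\<close>

definition ternary_path_tree :: "nat \<Rightarrow> (nat list \<times> nat) ugraph" where
  "ternary_path_tree l =
     ((\<Union>m \<le> l. ternary_words m) \<times> {2} \<union> ternary_words l \<times> {0..4},
      {{(w, 2), (i # w, 2)} | w i. w \<in> (\<Union>m < l. ternary_words m) \<and> i \<in> {0, 1, 2}} \<union>
      {{(w, j), (w, Suc j)} | w j. w \<in> ternary_words l \<and> j < 4})"

end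

theory Submission
  imports Defs "HOL-Library.Multiset"
begin

text \<open>
  Splitting vertices turns a connected graph \<open>G\<close> into a rooted tree on the same edges, and connected
  parts of the tree are connected in \<open>G\<close>. Descending along heaviest branches and adding the branches
  at each vertex one by one gives a chain of edge sets whose successive differences are connected.
  Its sizes grow at most by a factor of 2, so a 4-adically spaced subchain has about
  \<open>log\<^sub>4 e(G)\<close> members, and every choice of \<open>k - 1\<close> of them yields a different partition.

  For \<open>k = 2\<close>, a vertex with \<open>d\<close> branches contributes \<open>d\<close> members to the chain while its heaviest
  branch has at least a \<open>1/d\<close> fraction of the edges. Optimizing over \<open>d\<close> and rooting the tree at a
  centroid gives at least \<open>3 l + 1\<close> partitions. In \<open>T(l)\<close> a part of a connected 2-partition is a
  union of branches at some vertex, which leaves only \<open>3 l + 1\<close> sizes.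
\<close>

section \<open>Reachability\<close>

abbreviation reach :: "'a set set \<Rightarrow> 'a \<Rightarrow> 'a \<Rightarrow> bool" where
  "reach F u v \<equiv> (u, v) \<in> {(x, y). {x, y} \<in> F}\<^sup>*"

text \<open>For a nonempty \<open>F\<close> of two-element edges this says that \<open>F\<close> is
  connected and meets \<open>x\<close>. The empty set qualifies at every vertex, so unions of
  branches need no case split.\<close>

definition hang :: "'a \<Rightarrow> 'a set set \<Rightarrow> bool" where
  "hang x F \<longleftrightarrow> (\<forall>u \<in> \<Union>F. reach F x u)"

lemma reach_sym: "reach F u v \<Longrightarrow> reach F v u"
proof -
  have "sym {(x, y). {x, y} \<in> F}"
    by (auto simp: sym_def insert_commute)
  then show "reach F u v \<Longrightarrow> reach F v u"
    by (meson sym_rtrancl symD)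
qed

lemma reach_mono: "reach F u v \<Longrightarrow> F \<subseteq> F' \<Longrightarrow> reach F' u v"
  by (rule rtrancl_mono[THEN subsetD]) auto

lemma hang_empty [simp]: "hang x {}"
  by (simp add: hang_def)

lemma reach_trans: "reach F u v \<Longrightarrow> reach F v w \<Longrightarrow> reach F u w"
  by (rule rtrancl_trans)

lemma hang_Un: "hang x F \<Longrightarrow> hang x F' \<Longrightarrow> hang x (F \<union> F')"
  unfolding hang_def using reach_mono[where F' = "F \<union> F'"] by blast

lemma hang_insert: "hang y F \<Longrightarrow> hang x (insert {x, y} F)"
proof -
  assume h: "hang y F"
  let ?F = "insert {x, y} F"
  have xy: "reach ?F x y" by (rule r_into_rtrancl) auto
  have "reach ?F x u" if "u \<in> \<Union>F" for u
    using h that reach_trans[OF xy] reach_mono[where F = F and F' = ?F] unfolding hang_def by blast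
  then show ?thesis
    using xy unfolding hang_def by auto
qed

lemma hang_connected:
  assumes "hang x F" "finite F" "F \<noteq> {}" "\<forall>e\<in>F. card e = 2"
  shows "connected_graph (\<Union>F, F)"
proof -
  have fin: "\<forall>e\<in>F. finite e" using assms(4) by (metis card.infinite zero_neq_numeral)
  obtain e where "e \<in> F" using assms(3) by auto
  then have ne: "\<Union>F \<noteq> {}" using assms(4) by fastforce
  have "reach F u v" if "u \<in> \<Union>F" "v \<in> \<Union>F" for u v
    using that assms(1) reach_trans[OF reach_sym[of x u F]] unfolding hang_def by blast
  then show ?thesis
    using fin ne assms unfolding connected_graph_def simple_graph_def by auto
qed

section \<open>Rooted trees with labelled vertices\<close>

text \<open>Labels may repeat: a rooted tree whose edge list enumerates the edges of a connected graph
  without repetition arises from the graph by splitting vertices.\<close>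

datatype 'a rtree = Node (root: 'a) (kids: "'a rtree list")

fun labs :: "'a rtree \<Rightarrow> 'a list" where
  "labs (Node x ts) = x # concat (map labs ts)"

text \<open>The order is postorder: the edge to a child directly follows the edges below that child.
  What a cut leaves of a child's list is thus tied to \<open>x\<close> by the next edge.\<close>

fun elist :: "'a rtree \<Rightarrow> 'a set list" where
  "elist (Node x ts) = concat (map (\<lambda>c. elist c @ [{x, root c}]) ts)"

abbreviation esize :: "'a rtree \<Rightarrow> nat" where
  "esize t \<equiv> length (elist t)"

abbreviation branches :: "'a rtree list \<Rightarrow> nat list" where
  "branches ts \<equiv> map (\<lambda>c. Suc (esize c)) ts"

lemma root_labs [simp]: "root t \<in> set (labs t)"
  by (cases t) auto

lemma elist_subset_labs: "e \<in> set (elist t) \<Longrightarrow> e \<subseteq> set (labs t)"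
  by (induction t arbitrary: e) fastforce

lemma length_labs: "length (labs t) = Suc (esize t)"
proof (induction t)
  case (Node x ts)
  then have "map (\<lambda>c. length (labs c)) ts = branches ts" by simp
  then show ?case by (simp add: length_concat comp_def del: map_eq_conv)
qed

lemma esize_Node: "esize (Node x ts) = sum_list (branches ts)"
  by (simp add: length_concat comp_def)

lemma hang_branches:
  "(\<And>c. c \<in> set ts \<Longrightarrow> hang (root c) (set (elist c))) \<Longrightarrow>
   hang x (set (concat (map (\<lambda>c. elist c @ [{x, root c}]) ts)))"
proof (induction ts)
  case (Cons c cs)
  have "hang x (insert {x, root c} (set (elist c)))"
    by (rule hang_insert) (simp add: Cons.prems)
  moreover have "hang x (set (concat (map (\<lambda>c. elist c @ [{x, root c}]) cs)))"
    using Cons by simp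
  ultimately show ?case using hang_Un by fastforce
qed simp

lemma hang_elist: "hang (root t) (set (elist t))"
proof (induction t)
  case (Node x ts)
  then show ?case using hang_branches[of ts x] by simp
qed

text \<open>A new leaf labelled \<open>w\<close> is hung below an occurrence of \<open>u\<close>,
  even if \<open>w\<close> already labels another node; this is where vertices get split.\<close>

lemma ex_attach:
  "u \<in> set (labs t) \<Longrightarrow>
   \<exists>t'. root t' = root t \<and> mset (elist t') = add_mset {u, w} (mset (elist t))"
proof (induction t)
  case (Node x ts)
  show ?case
  proof (cases "u = x")
    case True
    then show ?thesis by (intro exI[of _ "Node x (Node w [] # ts)"]) simp
  next
    case False
    then obtain c where c: "c \<in> set ts" "u \<in> set (labs c)" using Node.prems by auto
    then obtain c' where c': "root c' = root c" "mset (elist c') = add_mset {u, w} (mset (elist c))"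
      using Node.IH by blast
    obtain as bs where ts: "ts = as @ c # bs" using c(1) by (meson split_list)
    show ?thesis
      by (intro exI[of _ "Node x (as @ c' # bs)"]) (simp add: ts c')
  qed
qed

section \<open>Growing a rooted tree inside a connected graph\<close>

lemma reach_exits:
  assumes "reach F u v" "u \<in> S" "v \<notin> S"
  shows "\<exists>p q. {p, q} \<in> F \<and> p \<in> S \<and> q \<notin> S"
  using assms by (induction rule: rtrancl_induct) auto

text \<open>Greedy growth: if \<open>f\<close> is missing, then some missing edge meets the labels,
  namely \<open>f\<close> itself or an edge on which a path from the root to an end of
  \<open>f\<close> leaves the labels. Every size \<open>m\<close> is kept because
  \<open>num_edge_partitions_pos\<close> needs a connected part of prescribed size.\<close>

lemma ex_rtree:
  assumes G: "connected_graph G" and "m \<le> card (edges G)"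
  shows "\<exists>t. root t \<in> verts G \<and> distinct (elist t) \<and> set (elist t) \<subseteq> edges G \<and> esize t = m"
  using assms(2)
proof (induction m)
  case 0
  obtain r where "r \<in> verts G" using G unfolding connected_graph_def by auto
  then show ?case by (intro exI[of _ "Node r []"]) simp
next
  case (Suc m)
  then obtain t where t: "root t \<in> verts G" "distinct (elist t)" "set (elist t) \<subseteq> edges G"
      "esize t = m"
    by auto
  then have "card (set (elist t)) = m" by (simp add: distinct_card)
  then have "set (elist t) \<noteq> edges G" using Suc.prems by auto
  then obtain f where f: "f \<in> edges G" "f \<notin> set (elist t)" using t(3) by auto
  then have "f \<subseteq> verts G" "card f = 2" using G unfolding connected_graph_def simple_graph_def by auto
  then obtain a b where ab: "f = {a, b}" "a \<in> verts G" by (auto simp: card_2_iff)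
  have "\<exists>p q. {p, q} \<in> edges G - set (elist t) \<and> p \<in> set (labs t)"
  proof (cases "a \<in> set (labs t)")
    case True
    then show ?thesis using f ab by auto
  next
    case False
    have "reach (edges G) (root t) a" using G t(1) ab(2) unfolding connected_graph_def by auto
    from reach_exits[OF this root_labs False] obtain p q
      where "{p, q} \<in> edges G" "p \<in> set (labs t)" "q \<notin> set (labs t)" by auto
    then show ?thesis using elist_subset_labs[of "{p, q}" t] by auto
  qed
  then obtain p q where pq: "{p, q} \<in> edges G" "{p, q} \<notin> set (elist t)" "p \<in> set (labs t)" by auto
  obtain t' where t': "root t' = root t" "mset (elist t') = mset ({p, q} # elist t)"
    using ex_attach[OF pq(3), of q] by auto
  have "distinct (elist t')" using mset_eq_imp_distinct_iff[OF t'(2)] pq t by simp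
  moreover have "set (elist t') \<subseteq> edges G" using mset_eq_setD[OF t'(2)] pq t by simp
  moreover have "esize t' = Suc m" using mset_eq_length[OF t'(2)] t by simp
  ultimately show ?case using t'(1) t(1) by metis
qed

definition represents :: "'a rtree \<Rightarrow> 'a ugraph \<Rightarrow> bool" where
  "represents t G \<longleftrightarrow> distinct (elist t) \<and> set (elist t) = edges G"

lemma represents_mset: "represents t G \<Longrightarrow> mset (elist t') = mset (elist t) \<Longrightarrow> represents t' G"
  unfolding represents_def using mset_eq_imp_distinct_iff mset_eq_setD by metis

lemma represents_esize: "represents t G \<Longrightarrow> esize t = card (edges G)"
  unfolding represents_def using distinct_card by metis

lemma connected_finite_edges: "connected_graph G \<Longrightarrow> finite (edges G)"
  unfolding connected_graph_def simple_graph_def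
  by (meson Pow_iff finite_Pow_iff finite_subset subsetI)

lemma ex_represents:
  assumes G: "connected_graph G"
  shows "\<exists>t. root t \<in> verts G \<and> represents t G"
proof -
  obtain t where t: "root t \<in> verts G" "distinct (elist t)" "set (elist t) \<subseteq> edges G"
      "esize t = card (edges G)"
    using ex_rtree[OF G order_refl] by auto
  then have "set (elist t) = edges G"
    using connected_finite_edges[OF G] by (simp add: card_subset_eq distinct_card)
  then show ?thesis using t unfolding represents_def by auto
qed

text \<open>The labels of a representing tree cover all vertices, and its label list has one entry
  more than its edge list.\<close>

lemma card_verts_le:
  assumes G: "connected_graph G"
  shows "card (verts G) \<le> Suc (card (edges G))"
proof -
  obtain t where t: "root t \<in> verts G" "represents t G" using ex_represents[OF G] by auto
  have "verts G \<subseteq> set (labs t)"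
  proof
    fix v assume "v \<in> verts G"
    then have "reach (edges G) (root t) v" using G t(1) unfolding connected_graph_def by auto
    then show "v \<in> set (labs t)"
    proof (rule contrapos_pp)
      assume "v \<notin> set (labs t)"
      then show "\<not> reach (edges G) (root t) v"
        using reach_exits[OF _ root_labs, of t v "edges G"] elist_subset_labs t(2)
        unfolding represents_def by (metis insert_subset)
    qed
  qed
  then have "card (verts G) \<le> card (set (labs t))" by (simp add: card_mono)
  also have "\<dots> \<le> length (labs t)" by (rule card_length)
  finally show ?thesis by (simp add: length_labs represents_esize[OF t(2)])
qed

section \<open>Cut positions\<close>

text \<open>\<open>cuts t\<close> follows the first child. The edges in \<open>elist t\<close> between two cut positions always form a
  connected graph.\<close>

fun cuts :: "'a rtree \<Rightarrow> nat set" where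
  "cuts (Node x []) = {}"
| "cuts (Node x (c # cs)) =
     cuts c \<union> (\<lambda>i. sum_list (take i (branches (c # cs)))) ` {1..length (c # cs)}"

text \<open>Only the spine of first children is constrained, since \<open>cuts\<close> never enters
  the other branches.\<close>

fun heavy :: "'a rtree \<Rightarrow> bool" where
  "heavy (Node x []) \<longleftrightarrow> True"
| "heavy (Node x (c # cs)) \<longleftrightarrow> heavy c \<and> (\<forall>d \<in> set cs. esize d \<le> esize c)"

lemma cuts_le: "i \<in> cuts t \<Longrightarrow> 1 \<le> i \<and> i \<le> esize t"
proof (induction t rule: cuts.induct)
  case (2 x c cs)
  show ?case
  proof (cases "i \<in> cuts c")
    case True
    then show ?thesis using 2 by (simp add: length_concat comp_def)
  next
    case False
    then obtain j where j: "i = sum_list (take j (branches (c # cs)))" "1 \<le> j"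
      using "2.prems" by auto
    have "sum_list (take j (branches (c # cs))) + sum_list (drop j (branches (c # cs)))
        = esize (Node x (c # cs))"
      by (metis append_take_drop_id esize_Node sum_list_append)
    moreover have "1 \<le> i" using j by (cases j) auto
    ultimately show ?thesis using j by linarith
  qed
qed simp

lemma esize_in_cuts: "0 < esize t \<Longrightarrow> esize t \<in> cuts t"
proof -
  assume "0 < esize t"
  then obtain x c cs where 2: "t = Node x (c # cs)" by (cases t rule: cuts.cases) auto
  have "esize t = sum_list (take (length (c # cs)) (branches (c # cs)))"
    unfolding 2 esize_Node by simp
  then show ?thesis unfolding 2 cuts.simps
    by (intro UnI2 image_eqI[where x = "length (c # cs)"]) simp_all
qed

lemma take_concat_sum:
  "take (sum_list (take i (map length xss))) (concat xss) = concat (take i xss)"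
proof (induction xss arbitrary: i)
  case (Cons xs xss)
  then show ?case by (cases i) auto
qed simp

lemma drop_concat_sum:
  "drop (sum_list (take i (map length xss))) (concat xss) = concat (drop i xss)"
proof (induction xss arbitrary: i)
  case (Cons xs xss)
  then show ?case by (cases i) auto
qed simp

lemma take_branches:
  "take (sum_list (take i (branches ts))) (elist (Node x ts)) = elist (Node x (take i ts))"
  using take_concat_sum[of i "map (\<lambda>c. elist c @ [{x, root c}]) ts"]
  by (simp add: comp_def take_map)

lemma drop_branches:
  "drop (sum_list (take i (branches ts))) (elist (Node x ts)) = elist (Node x (drop i ts))"
  using drop_concat_sum[of i "map (\<lambda>c. elist c @ [{x, root c}]) ts"]
  by (simp add: comp_def drop_map)

text \<open>Beyond a cut inside \<open>c\<close> there remain a part of \<open>c\<close> hanging at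
  \<open>root c\<close>, the edge \<open>{x, root c}\<close>, and whole branches at
  \<open>x\<close>; beyond a cut at \<open>x\<close> itself only whole branches remain.\<close>

lemma hang_drop: "i \<in> insert 0 (cuts t) \<Longrightarrow> hang (root t) (set (drop i (elist t)))"
proof (induction t rule: cuts.induct)
  case (2 x c cs)
  show ?case
  proof (cases "i \<in> insert 0 (cuts c)")
    case True
    then have le: "i \<le> esize c" using cuts_le by auto
    have "hang x (insert {x, root c} (set (drop i (elist c))))"
      using 2 True by (intro hang_insert) blast
    then have "hang x (insert {x, root c} (set (drop i (elist c))) \<union> set (elist (Node x cs)))"
      using hang_Un hang_elist[of "Node x cs"] by (metis rtree.sel(1))
    moreover have "drop i (elist (Node x (c # cs))) = drop i (elist c) @ {x, root c} # elist (Node x cs)"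
      using le by simp
    ultimately show ?thesis
      by (simp only: set_append list.set rtree.sel Un_insert_left Un_insert_right)
  next
    case False
    then obtain j where "i = sum_list (take j (branches (c # cs)))"
      using "2.prems" by auto
    then show ?thesis
      using hang_elist[of "Node x (drop j (c # cs))"] drop_branches by (metis rtree.sel(1))
  qed
qed simp

text \<open>For a nonempty segment, \<open>v\<close> is the vertex whose branches produce the upper
  cut \<open>j\<close>. The positions need not be ordered: for \<open>i \<ge> j\<close> the segment
  is empty.\<close>

lemma hang_segment:
  "i \<in> insert 0 (cuts t) \<Longrightarrow> j \<in> cuts t \<Longrightarrow> \<exists>v. hang v (set (drop i (take j (elist t))))"
proof (induction t rule: cuts.induct)
  case (2 x c cs)
  show ?case
  proof (cases "j \<in> cuts c")
    case True
    then have le: "j \<le> esize c" using cuts_le by auto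
    show ?thesis
    proof (cases "i \<in> insert 0 (cuts c)")
      case i: True
      have "take j (elist (Node x (c # cs))) = take j (elist c)" using le by simp
      then show ?thesis using 2 i True by metis
    next
      case False
      then obtain q where "i = sum_list (take q (branches (c # cs)))" "1 \<le> q"
        using "2.prems" by auto
      then have "esize c < i" by (cases q) auto
      then have "drop i (take j (elist (Node x (c # cs)))) = []" using le by simp
      then show ?thesis by (metis hang_empty list.set(1))
    qed
  next
    case False
    then obtain q where q: "j = sum_list (take q (branches (c # cs)))" "1 \<le> q"
      using "2.prems" by auto
    let ?s = "Node x (take q (c # cs))"
    have tk: "take j (elist (Node x (c # cs))) = elist ?s"
      unfolding q(1) by (rule take_branches)
    \<comment> \<open>Keeping \<open>q \<ge> 1\<close> branches keeps the first child
      \<open>c\<close>, so cuts inside \<open>c\<close> are also cuts of the truncated tree and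
      \<open>hang_drop\<close> applies to it.\<close>
    have s: "?s = Node x (c # take (q - 1) cs)" using q by (cases q) auto
    show ?thesis
    proof (cases "i \<in> insert 0 (cuts c)")
      case i: True
      then have "i \<in> insert 0 (cuts ?s)" unfolding s by auto
      then show ?thesis using hang_drop tk by metis
    next
      case False
      then obtain p where p: "i = sum_list (take p (branches (c # cs)))" "1 \<le> p"
        using "2.prems" by auto
      show ?thesis
      proof (cases "p \<le> q")
        case True
        then have "i = sum_list (take p (branches (take q (c # cs))))"
          unfolding p(1) by (simp add: take_map[symmetric] min_def del: take_map list.map)
        then have "drop i (elist ?s) = elist (Node x (drop p (take q (c # cs))))"
          using drop_branches by metis
        then show ?thesis using tk hang_elist by metis
      next
        case False
        have "sum_list (take q (branches (c # cs))) \<le> sum_list (take p (branches (c # cs)))"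
        proof -
          have "take p (branches (c # cs)) = take q (branches (c # cs)) @ take (p - q) (drop q (branches (c # cs)))"
            using False by (metis le_add_diff_inverse nat_le_linear take_add)
          then show ?thesis by (simp del: list.map)
        qed
        then have "drop i (take j (elist (Node x (c # cs)))) = []" using p q by simp
        then show ?thesis by (metis hang_empty list.set(1))
      qed
    qed
  qed
qed simp

section \<open>Partitions from cut positions\<close>

text \<open>Cut positions are listed in decreasing order, and a final 0 closes the list so that the
  gaps sum to its head.\<close>

fun gaps :: "nat list \<Rightarrow> nat list" where
  "gaps (a # b # ws) = (a - b) # gaps (b # ws)"
| "gaps ws = []"

fun segments :: "'b list \<Rightarrow> nat list \<Rightarrow> 'b set list" where
  "segments L (a # b # ws) = set (drop b (take a L)) # segments L (b # ws)"
| "segments L ws = []"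

lemma length_gaps [simp]: "length (gaps ws) = length ws - 1"
  by (induction ws rule: gaps.induct) auto

lemma length_segments [simp]: "length (segments L ws) = length ws - 1"
  by (induction L ws rule: segments.induct) auto

lemma sum_gaps: "sorted_wrt (>) (a # ws) \<Longrightarrow> sum_list (gaps (a # ws)) = a - last (a # ws)"
proof (induction ws arbitrary: a)
  case (Cons b ws)
  have "last (b # ws) \<le> b" using Cons.prems by (cases ws rule: rev_cases) auto
  then show ?case using Cons by simp
qed simp

lemma Union_segments:
  "sorted_wrt (>) (a # ws) \<Longrightarrow> last (a # ws) = 0 \<Longrightarrow> \<Union>(set (segments L (a # ws))) = set (take a L)"
proof (induction ws arbitrary: a)
  case (Cons b ws)
  have "take a L = take b L @ drop b (take a L)"
    using Cons.prems append_take_drop_id[of b "take a L"] by (simp add: min_def)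
  then have "set (take a L) = set (take b L) \<union> set (drop b (take a L))"
    by (metis set_append)
  then show ?case using Cons by (simp add: Un_commute)
qed simp

lemma disjoint_segments:
  "distinct L \<Longrightarrow> sorted_wrt (>) (a # ws) \<Longrightarrow> last (a # ws) = 0 \<Longrightarrow>
   sorted_wrt (\<lambda>X Y. X \<inter> Y = {}) (segments L (a # ws))"
proof (induction ws arbitrary: a)
  case (Cons b ws)
  have "distinct (take a L)" using Cons.prems by simp
  moreover have "take a L = take b L @ drop b (take a L)"
    using Cons.prems append_take_drop_id[of b "take a L"] by (simp add: min_def)
  ultimately have "set (drop b (take a L)) \<inter> set (take b L) = {}"
    by (metis distinct_append inf_commute)
  moreover have "\<Union>(set (segments L (b # ws))) = set (take b L)"
    using Cons.prems by (intro Union_segments) auto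
  ultimately have "\<forall>Y\<in>set (segments L (b # ws)). set (drop b (take a L)) \<inter> Y = {}"
    by blast
  then show ?case using Cons by simp
qed simp

lemma card_segments:
  "distinct L \<Longrightarrow> sorted_wrt (>) (a # ws) \<Longrightarrow> a \<le> length L \<Longrightarrow>
   map card (segments L (a # ws)) = gaps (a # ws)"
  by (induction ws arbitrary: a) (auto simp: distinct_card)

lemma in_segments:
  "X \<in> set (segments L (a # ws)) \<Longrightarrow> sorted_wrt (>) (a # ws) \<Longrightarrow>
   \<exists>i j. i < j \<and> j \<in> set (a # ws) \<and> i \<in> set ws \<and> X = set (drop i (take j L))"
proof (induction ws arbitrary: a)
  case (Cons b ws)
  show ?case
  proof (cases "X = set (drop b (take a L))")
    case True
    then show ?thesis using Cons.prems by auto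
  next
    case False
    then have "X \<in> set (segments L (b # ws))" "sorted_wrt (>) (b # ws)" using Cons.prems by auto
    from Cons.IH[OF this] obtain i j where
      "i < j" "j \<in> set (b # ws)" "i \<in> set ws" "X = set (drop i (take j L))" by blast
    then show ?thesis by (intro exI[of _ i] exI[of _ j]) auto
  qed
qed simp

lemma card_edge: "connected_graph G \<Longrightarrow> e \<in> edges G \<Longrightarrow> card e = 2"
  unfolding connected_graph_def simple_graph_def by auto

lemma connected_edge_partition_cuts:
  assumes G: "connected_graph G" and t: "represents t G"
    and ws: "sorted_wrt (>) (esize t # ws)" "last (esize t # ws) = 0"
      "esize t \<in> cuts t" "set ws \<subseteq> insert 0 (cuts t)"
  shows "connected_edge_partition G (gaps (esize t # ws)) (segments (elist t) (esize t # ws))"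
proof -
  let ?ws = "esize t # ws" and ?L = "elist t"
  have L: "distinct ?L" "set ?L = edges G" using t unfolding represents_def by auto
  have seg: "connected_graph (\<Union>X, X)" if X: "X \<in> set (segments ?L ?ws)" for X
  proof -
    obtain i j where ij: "i < j" "j \<in> set ?ws" "i \<in> set ws" "X = set (drop i (take j ?L))"
      using in_segments[OF X ws(1)] by auto
    \<comment> \<open>\<open>i < j\<close> excludes \<open>j = 0\<close>, so the upper end is a
      genuine cut.\<close>
    then have j: "j \<in> cuts t" "i \<in> insert 0 (cuts t)" using ws by auto
    have "j \<le> esize t" using cuts_le j by auto
    then have "X \<noteq> {}" using ij by simp
    moreover have "X \<subseteq> edges G" using ij L by (metis set_drop_subset set_take_subset subset_trans)
    moreover obtain v where "hang v X" using hang_segment[OF j(2,1)] ij by auto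
    moreover have "finite X" unfolding ij(4) by simp
    ultimately show ?thesis
      using card_edge[OF G] by (intro hang_connected[of v]) auto
  qed
  have "sum_list (gaps ?ws) = card (edges G)"
    using sum_gaps[OF ws(1)] ws(2) represents_esize[OF t] by simp
  moreover have "\<Union>(set (segments ?L ?ws)) = edges G"
    using Union_segments[OF ws(1,2), of ?L] L by simp
  moreover have "segments ?L ?ws ! i \<inter> segments ?L ?ws ! j = {}"
    if "i < length (segments ?L ?ws)" "j < length (segments ?L ?ws)" "i \<noteq> j" for i j
    using disjoint_segments[OF L(1) ws(1,2)] that unfolding sorted_wrt_iff_nth_less
    by (metis inf_commute nat_neq_iff)
  moreover have "card (segments ?L ?ws ! i) = gaps ?ws ! i"
    if "i < length (segments ?L ?ws)" for i
    using card_segments[OF L(1) ws(1)] that by (metis nth_map order_refl)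
  ultimately show ?thesis
    unfolding connected_edge_partition_def using seg by (auto simp del: gaps.simps segments.simps)
qed

text \<open>Lower bounds on the count rely on finiteness, as \<open>card\<close> of an infinite set
  is 0. Each entry is at most the number of edges.\<close>

lemma finite_partition_sizes:
  "finite {ms :: nat list. length ms = k \<and> sorted_wrt (\<ge>) ms \<and> (\<forall>m \<in> set ms. m \<ge> 1) \<and>
     (\<exists>Es. connected_edge_partition G ms Es)}"
proof (rule finite_subset)
  show "finite {ms. set ms \<subseteq> {..card (edges G)} \<and> length ms = k}"
    by (rule finite_lists_length_eq) simp
qed (auto simp: connected_edge_partition_def dest: member_le_sum_list)

lemma num_edge_partitions_ge:
  assumes "inj_on f A"
    "\<And>a. a \<in> A \<Longrightarrow> length (f a) = k \<and> sorted_wrt (\<ge>) (f a) \<and> (\<forall>m \<in> set (f a). m \<ge> 1) \<and>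
       (\<exists>Es. connected_edge_partition G (f a) Es)"
  shows "card A \<le> num_edge_partitions G k"
  unfolding num_edge_partitions_def
  by (rule card_inj_on_le[OF assms(1) _ finite_partition_sizes]) (use assms(2) in blast)

section \<open>Heavy first children\<close>

text \<open>A heaviest child moves to the front, and only that child is rearranged further. The
  clause on child sizes lets the centroid argument bound the new first branch.\<close>

lemma ex_heavy:
  "\<exists>t'. root t' = root t \<and> mset (elist t') = mset (elist t) \<and> heavy t' \<and>
     (\<forall>c' \<in> set (kids t'). \<exists>c \<in> set (kids t). esize c' = esize c)"
proof (induction t)
  case (Node x ts)
  show ?case
  proof (cases "ts = []")
    case True
    then show ?thesis by (intro exI[of _ "Node x []"]) simp
  next
    case False
    define m where "m = Max (esize ` set ts)"
    have "m \<in> esize ` set ts" unfolding m_def using False by (intro Max_in) auto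
    then obtain c where c: "c \<in> set ts" "esize c = m" by auto
    have m: "esize d \<le> m" if "d \<in> set ts" for d unfolding m_def using that by simp
    obtain c' where c': "root c' = root c" "mset (elist c') = mset (elist c)" "heavy c'"
      using Node.IH[OF c(1)] by auto
    have sz: "esize c' = esize c" using c'(2) by (rule mset_eq_length)
    obtain as bs where ts: "ts = as @ c # bs" using c(1) by (meson split_list)
    show ?thesis
      by (intro exI[of _ "Node x (c' # as @ bs)"]) (use m c' sz c ts in auto)
  qed
qed

lemma ex_heavy_represents:
  assumes "represents t G"
  shows "\<exists>t'. represents t' G \<and> heavy t'"
  using ex_heavy[of t] represents_mset[OF assms] by metis

text \<open>While the first branch is too large, the root moves across its top edge; the size of the
  first child decreases. The final bound is half of the number of nodes of the tree.\<close>

lemma ex_centroid: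
  assumes "represents t G" "heavy t" "kids t \<noteq> []"
  shows "\<exists>x c cs. represents (Node x (c # cs)) G \<and> heavy (Node x (c # cs)) \<and>
    2 * Suc (esize c) \<le> Suc (card (edges G))"
  using assms
proof (induction "esize (hd (kids t))" arbitrary: t rule: less_induct)
  case less
  obtain x c cs where t: "t = Node x (c # cs)" using less.prems(3) by (cases t; cases "kids t") auto
  obtain y ds where c: "c = Node y ds" by (cases c)
  show ?case
  proof (cases "2 * Suc (esize c) \<le> Suc (card (edges G))")
    case True
    then show ?thesis using less.prems t by blast
  next
    case False
    \<comment> \<open>Rerooting at \<open>y\<close>: the old root becomes a child carrying the other
      branches, with fewer edges than \<open>c\<close> because the branch of \<open>c\<close>
      exceeds half.\<close>
    let ?u = "Node y (Node x cs # ds)"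
    have E: "card (edges G) = Suc (esize c) + esize (Node x cs)"
      using represents_esize[OF less.prems(1)] t by simp
    have "mset (elist ?u) = mset (elist t)" unfolding t c by (simp add: insert_commute)
    then obtain t' where t': "mset (elist t') = mset (elist t)" "heavy t'"
        "\<forall>c' \<in> set (kids t'). \<exists>c \<in> set (kids ?u). esize c' = esize c"
      using ex_heavy[of ?u] by auto
    have "esize d < esize c" if "d \<in> set ds" for d
    proof -
      have "Suc (esize d) \<le> sum_list (branches ds)"
        using that by (intro member_le_sum_list) auto
      then show ?thesis unfolding c esize_Node by simp
    qed
    then have lt: "esize d < esize c" if "d \<in> set (kids ?u)" for d
      using that False E by auto
    have "esize t' = esize t" using t'(1) by (rule mset_eq_length)
    then have "esize t' > 0" unfolding t by simp
    then have "kids t' \<noteq> []" by (cases t') auto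
    then have "esize (hd (kids t')) < esize (hd (kids t))"
      using t'(3) lt list.set_sel(1)[of "kids t'"] unfolding t by (metis list.sel(1) rtree.sel(2))
    from less.hyps[OF this represents_mset[OF less.prems(1) t'(1)] t'(2) \<open>kids t' \<noteq> []\<close>]
    show ?thesis .
  qed
qed

section \<open>Partial sums of branch sizes\<close>

lemma sum_take_Suc: "i < length bs \<Longrightarrow> sum_list (take (Suc i) bs) = sum_list (take i bs) + bs ! i"
  for bs :: "nat list"
  by (simp add: take_Suc_conv_app_nth)

lemma sum_take_less:
  fixes bs :: "nat list"
  assumes "\<forall>b \<in> set bs. 1 \<le> b" "i < j" "j \<le> length bs"
  shows "sum_list (take i bs) < sum_list (take j bs)"
  using assms(2,3)
proof (induction j)
  case (Suc j)
  then have "1 \<le> bs ! j" using assms(1) by simp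
  then show ?case using Suc sum_take_Suc[of j bs] by (cases "i = j") auto
qed simp

lemma sum_take_le:
  fixes bs :: "nat list"
  assumes "\<forall>b \<in> set bs. b \<le> m"
  shows "sum_list (take i bs) \<le> i * m"
proof -
  have "sum_list (take i bs) \<le> length (take i bs) * m"
    using assms by (induction bs arbitrary: i) (auto simp: take_Cons' add_mono)
  also have "\<dots> \<le> i * m" by simp
  finally show ?thesis .
qed

lemma finite_cuts [simp]: "finite (cuts t)"
  by (rule finite_subset[of _ "{1..esize t}"]) (auto dest: cuts_le)

text \<open>Cuts inside \<open>c\<close> are at most \<open>esize c\<close>, whereas every partial
  sum at the root contains the whole first branch. A subset \<open>I\<close> is allowed because at a
  centroid only sums up to half of the edges are used.\<close>

lemma cuts_disjoint:
  assumes "I \<subseteq> {1..length (c # cs)}"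
  shows "card (cuts c \<union> (\<lambda>i. sum_list (take i (branches (c # cs)))) ` I) = card (cuts c) + card I"
proof -
  let ?S = "\<lambda>i. sum_list (take i (branches (c # cs)))"
  have "inj_on ?S I"
  proof (rule linorder_inj_onI)
    show "?S i \<noteq> ?S j" if "i < j" "i \<in> I" "j \<in> I" for i j
      using sum_take_less[of "branches (c # cs)" i j] that assms by fastforce
  qed auto
  moreover have "esize c < ?S i" if "i \<in> I" for i
    using that assms by (cases i) auto
  then have "cuts c \<inter> ?S ` I = {}" using cuts_le by fastforce
  ultimately show ?thesis
    using finite_subset[OF assms] by (simp add: card_Un_disjoint card_image)
qed

text \<open>If \<open>m\<close> exceeds \<open>esize c\<close>, the first partial sum reaching
  \<open>m\<close> is a sum below \<open>m\<close> plus one branch, and by heaviness that branch has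
  at most \<open>Suc (esize c) \<le> m\<close> edges.\<close>

lemma ex_cut_between:
  "heavy t \<Longrightarrow> 1 \<le> m \<Longrightarrow> m \<le> esize t \<Longrightarrow> \<exists>i \<in> cuts t. m \<le> i \<and> i < 2 * m"
proof (induction t rule: cuts.induct)
  case (2 x c cs)
  show ?case
  proof (cases "m \<le> esize c")
    case True
    then show ?thesis using 2 by auto
  next
    case False
    let ?bs = "branches (c # cs)"
    let ?S = "\<lambda>i. sum_list (take i ?bs)"
    define i where "i = (LEAST i. m \<le> ?S i)"
    have "m \<le> ?S (length ?bs)" using "2.prems" by (simp add: length_concat comp_def)
    then have i: "m \<le> ?S i" "i \<le> length ?bs" "\<And>j. j < i \<Longrightarrow> ?S j < m"
      unfolding i_def by (rule LeastI, rule Least_le) (metis linorder_not_le not_less_Least)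
    have i0: "i \<noteq> 0" using i(1) "2.prems" by (metis list.size(3) sum_list.Nil take0 not_one_le_zero le_zero_eq)
    have "?S i < 2 * m"
    proof -
      obtain j where j: "i = Suc j" using i0 by (cases i) auto
      have "?bs ! j \<le> Suc (esize c)" using "2.prems"(1) i(2) j by (cases j) auto
      moreover have "?S i = ?S j + ?bs ! j" unfolding j using i(2) j by (intro sum_take_Suc) simp
      moreover have "?S j < m" using i(3) j by simp
      ultimately show ?thesis using False by linarith
    qed
    moreover have "?S i \<in> cuts (Node x (c # cs))" using i(2) i0 unfolding cuts.simps
      by (intro UnI2 image_eqI[where x = i]) auto
    ultimately show ?thesis using i(1) by blast
  qed
qed simp


section \<open>Counting partitions into \<open>k\<close> parts\<close>

lemma gaps_le: "sorted_wrt (>) (a # ws) \<Longrightarrow> g \<in> set (gaps (a # ws)) \<Longrightarrow> g \<le> a"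
  by (induction ws arbitrary: a) fastforce+

lemma gaps_pos: "sorted_wrt (>) ws \<Longrightarrow> g \<in> set (gaps ws) \<Longrightarrow> 1 \<le> g"
  by (induction ws rule: gaps.induct) auto

text \<open>Halving makes \<open>a - b\<close> at least \<open>b\<close>, and \<open>b\<close>
  bounds all later gaps.\<close>

lemma gaps_sorted:
  "sorted_wrt (\<lambda>a b. b < a \<and> 2 * b \<le> a) ws \<Longrightarrow> sorted_wrt (\<ge>) (gaps ws)"
proof (induction ws rule: gaps.induct)
  case (1 a b ws)
  have "sorted_wrt (>) (b # ws)"
    using 1(2) sorted_wrt_mono_rel[of "b # ws" "\<lambda>a b. b < a \<and> 2 * b \<le> a" "(>)"] by simp
  then have "\<forall>g \<in> set (gaps (b # ws)). g \<le> b" using gaps_le by blast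
  then show ?case using 1 by fastforce
qed auto

lemma gaps_inject:
  "sorted_wrt (>) (a # ws) \<Longrightarrow> sorted_wrt (>) (a # ws') \<Longrightarrow> gaps (a # ws) = gaps (a # ws') \<Longrightarrow> ws = ws'"
proof (induction ws arbitrary: a ws')
  case Nil
  then show ?case by (cases ws') auto
next
  case (Cons b ws)
  then obtain b' us where ws': "ws' = b' # us" by (cases ws') auto
  then have "b = b'" using Cons.prems by auto
  then show ?case using Cons ws' by auto
qed

text \<open>One cut is picked in each window from \<open>4 ^ j\<close> to \<open>2 * 4 ^ j\<close>;
  each choice of \<open>k - 1\<close> windows gives its own tuple of sizes.\<close>

lemma binomial_le_num_edge_partitions:
  assumes G: "connected_graph G" and k: "2 \<le> k" and q: "4 ^ q \<le> card (edges G)"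
  shows "q choose (k - 1) \<le> num_edge_partitions G k"
proof -
  obtain t where t: "represents t G" "heavy t"
    using ex_represents[OF G] ex_heavy_represents by metis
  let ?E = "esize t"
  have E: "?E = card (edges G)" using represents_esize[OF t(1)] .
  have "\<exists>i \<in> cuts t. 4 ^ j \<le> i \<and> i < 2 * 4 ^ j" if "j < q" for j
  proof -
    have "(4::nat) ^ j \<le> 4 ^ q" using that by simp
    then have "4 ^ j \<le> ?E" using q E by linarith
    then show ?thesis by (intro ex_cut_between t(2)) auto
  qed
  then obtain y where y: "\<And>j. j < q \<Longrightarrow> y j \<in> cuts t \<and> 4 ^ j \<le> y j \<and> y j < 2 * 4 ^ j" by metis
  \<comment> \<open>The factor 2 keeps the gaps sorted; \<open>b < a\<close> adds something only for
    the final \<open>b = 0\<close>.\<close>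
  let ?R = "\<lambda>a b :: nat. b < a \<and> 2 * b \<le> a"
  have y4: "2 * y i \<le> 4 ^ j" if "i < j" "j \<le> q" for i j
  proof -
    have "(4::nat) ^ Suc i \<le> 4 ^ j" using that by (intro power_increasing) auto
    then show ?thesis using y[of i] that by simp
  qed
  have ypos: "0 < y j" if "j < q" for j using y[OF that] by (metis gr0I le_zero_eq power_not_zero zero_neq_numeral)
  have yR: "?R (y j) (y i)" if "i < j" "j < q" for i j
    using y4[of i j] y[of j] ypos[of i] that by linarith
  have ER: "?R ?E (y j)" if "j < q" for j
    using y4[of j q] ypos[of j] that q E by linarith
  define ws where "ws J = rev (map y (sorted_list_of_set J)) @ [0]" for J
  define A where "A = {J. J \<subseteq> {..<q} \<and> card J = k - 1}"
  have A: "finite J" "J \<subseteq> {..<q}" "card J = k - 1" if "J \<in> A" for J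
    using that finite_subset unfolding A_def by auto
  have E0: "0 < ?E" using q E by (metis gr0I le_zero_eq power_not_zero zero_neq_numeral)
  have sorted: "sorted_wrt ?R (?E # ws J)" if J: "J \<in> A" for J
  proof -
    have "sorted_wrt (<) (sorted_list_of_set J)" by simp
    then have "sorted_wrt (\<lambda>i j. ?R (y j) (y i)) (sorted_list_of_set J)"
      by (rule sorted_wrt_mono_rel[rotated]) (use yR A[OF J] in auto)
    then show ?thesis unfolding ws_def
      using A[OF J] ER E0 ypos by (auto simp: sorted_wrt_append sorted_wrt_rev sorted_wrt_map)
  qed
  then have sorted': "sorted_wrt (>) (?E # ws J)" if J: "J \<in> A" for J
    using that by (intro sorted_wrt_mono_rel[OF _ sorted]) auto
  have "inj_on (\<lambda>J. gaps (?E # ws J)) A"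
  proof (rule inj_onI)
    fix J J' assume J: "J \<in> A" "J' \<in> A" "gaps (?E # ws J) = gaps (?E # ws J')"
    then have "ws J = ws J'" using gaps_inject sorted' by blast
    then have "set (map y (sorted_list_of_set J)) = set (map y (sorted_list_of_set J'))"
      unfolding ws_def by simp
    then have "y ` J = y ` J'" using A J by simp
    moreover have "inj_on y {..<q}"
      by (rule linorder_inj_onI) (use yR in force)+
    ultimately show "J = J'" using A J by (metis inj_on_image_eq_iff)
  qed
  then have "card A \<le> num_edge_partitions G k"
  proof (rule num_edge_partitions_ge)
    fix J assume J: "J \<in> A"
    have "length (ws J) = k" unfolding ws_def using A[OF J] k by simp
    moreover have "set (ws J) \<subseteq> insert 0 (cuts t)" unfolding ws_def using A[OF J] y by auto
    moreover have "last (?E # ws J) = 0" unfolding ws_def by simp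
    ultimately show "length (gaps (?E # ws J)) = k \<and> sorted_wrt (\<ge>) (gaps (?E # ws J)) \<and>
        (\<forall>m \<in> set (gaps (?E # ws J)). m \<ge> 1) \<and> (\<exists>Es. connected_edge_partition G (gaps (?E # ws J)) Es)"
      using connected_edge_partition_cuts[OF G t(1) sorted'[OF J]] gaps_sorted[OF sorted[OF J]]
        gaps_pos[OF sorted'[OF J]] esize_in_cuts[OF E0] by auto
  qed
  moreover have "card A = q choose (k - 1)"
    unfolding A_def using n_subsets[of "{..<q}" "k - 1"] by simp
  ultimately show ?thesis by simp
qed

text \<open>One connected set of \<open>m\<close> edges and \<open>k - 1\<close> single edges
  suffice. This covers the range where the binomial bound is 0.\<close>

lemma num_edge_partitions_pos:
  assumes G: "connected_graph G" and k: "1 \<le> k" "k \<le> card (edges G)"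
  shows "1 \<le> num_edge_partitions G k"
proof -
  let ?E = "card (edges G)"
  define m where "m = ?E - (k - 1)"
  obtain t where t: "distinct (elist t)" "set (elist t) \<subseteq> edges G" "esize t = m"
    using ex_rtree[OF G, of m] unfolding m_def by auto
  have fin: "finite (edges G)" using connected_finite_edges[OF G] .
  let ?F = "set (elist t)"
  have F: "card ?F = m" using t distinct_card by auto
  obtain rs where rs: "set rs = edges G - ?F" "distinct rs"
    using fin finite_distinct_list by (metis finite_Diff)
  have "length rs = ?E - m"
    using rs t(2) F fin by (metis card_Diff_subset distinct_card finite_set)
  then have lrs: "length rs = k - 1" unfolding m_def using k by simp
  let ?Es = "?F # map (\<lambda>e. {e}) rs" and ?ms = "m # replicate (k - 1) 1"
  have m: "m \<ge> 1" unfolding m_def using k by simp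
  have single: "connected_graph (\<Union>{e}, {e})" if e: "e \<in> edges G" for e
  proof -
    obtain u v where "e = {u, v}" using card_edge[OF G e] by (auto simp: card_2_iff)
    then have "hang u {e}" using hang_insert[of v "{}" u] by simp
    then show ?thesis using card_edge[OF G e] by (intro hang_connected) auto
  qed
  have "connected_graph (\<Union>?F, ?F)"
    using hang_elist[of t] F m t(2) card_edge[OF G] by (intro hang_connected) auto
  moreover have "connected_graph (\<Union>(?Es ! Suc i), ?Es ! Suc i)" if "i < length rs" for i
    using single[of "rs ! i"] that rs nth_mem[OF that] by auto
  ultimately have 1: "connected_graph (\<Union>(?Es ! i), ?Es ! i)" if "i < length ?Es" for i
    using that by (cases i) auto
  have 2: "card (?Es ! i) = ?ms ! i" if "i < length ?Es" for i
    using that F lrs by (cases i) auto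
  have "sorted_wrt (\<noteq>) rs"
    using rs(2) by (induction rs) auto
  then have "sorted_wrt (\<lambda>X Y. X \<inter> Y = {}) ?Es"
    using rs(1) by (auto simp: sorted_wrt_map)
  then have 3: "?Es ! i \<inter> ?Es ! j = {}" if "i < length ?Es" "j < length ?Es" "i \<noteq> j" for i j
    using that unfolding sorted_wrt_iff_nth_less by (metis inf_commute nat_neq_iff)
  have 4: "\<Union>(set ?Es) = edges G" using rs t(2) by auto
  have "sorted_wrt (\<ge>) (replicate (k - 1) (1::nat))"
    by (simp add: sorted_wrt_iff_nth_less)
  then have srt: "sorted_wrt (\<ge>) ?ms" using m by simp
  have 5: "sum_list ?ms = card (edges G)" unfolding m_def using k by (simp add: sum_list_replicate)
  have "connected_edge_partition G ?ms ?Es"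
    unfolding connected_edge_partition_def using 1 2 3 4 5 lrs by (auto simp del: nth_Cons_Suc)
  then have "card {()} \<le> num_edge_partitions G k"
    using m k srt by (intro num_edge_partitions_ge[where f = "\<lambda>_. ?ms"]) (auto simp del: sorted_wrt.simps)
  then show ?thesis by simp
qed

text \<open>For the largest \<open>q\<close> with \<open>4 ^ q \<le> ?E\<close>,
  \<open>?n \<le> 2 * ?E < 2 ^ (2 * q + 3)\<close> and \<open>ln 2 < 1\<close> give
  \<open>ln ?n \<le> 2 * q + 3\<close>. This is at most \<open>5 * q\<close> if
  \<open>k - 1 \<le> q\<close>, and otherwise at most \<open>5 * (k - 1)\<close>, so that a single
  partition is enough; hence the constant 5.\<close>

lemma num_edge_partitions_log:
  assumes G: "connected_graph G" and k: "2 \<le> k" "k \<le> card (edges G)"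
  shows "real (num_edge_partitions G k) \<ge>
    (1 / (5 * real (k - 1))) ^ (k - 1) * ln (real (card (verts G))) ^ (k - 1)"
proof -
  let ?E = "card (edges G)" and ?n = "card (verts G)"
  define q where "q = (GREATEST q. 4 ^ q \<le> ?E)"
  have bd: "p \<le> ?E" if "4 ^ p \<le> ?E" for p
  proof -
    have "p < 4 ^ p" by (rule power_gt_expt) simp
    then show ?thesis using that by linarith
  qed
  have q: "4 ^ q \<le> ?E"
    unfolding q_def
  proof (rule GreatestI_nat)
    show "4 ^ 0 \<le> ?E" using k by simp
  qed (rule bd)
  have q': "?E < 4 ^ Suc q"
    using Greatest_le_nat[of "\<lambda>q. 4 ^ q \<le> ?E" "Suc q", OF _ bd] unfolding q_def[symmetric] by linarith
  have "?n \<le> 2 * ?E" using card_verts_le[OF G] k by linarith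
  then have "?n \<le> 2 * 4 ^ Suc q" using q' by linarith
  then have n: "?n \<le> 2 ^ (2 * q + 3)" by (simp add: power_add power_mult)
  have "?n > 0" using G unfolding connected_graph_def simple_graph_def by auto
  have ln: "0 \<le> ln (real ?n)" using \<open>?n > 0\<close> by simp
  have "real ?n \<le> 2 ^ (2 * q + 3)" using n by (metis of_nat_le_iff of_nat_numeral of_nat_power)
  then have "ln (real ?n) \<le> ln (2 ^ (2 * q + 3))" using \<open>?n > 0\<close> by simp
  also have "\<dots> = real (2 * q + 3) * ln 2" by (rule ln_realpow)
  also have "\<dots> \<le> real (2 * q + 3) * 1" by (intro mult_left_mono) (use ln_2_less_1 in auto)
  finally have le: "ln (real ?n) \<le> real (2 * q + 3)" by simp
  let ?x = "1 / (5 * real (k - 1)) * ln (real ?n)"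
  have "?x ^ (k - 1) \<le> real (num_edge_partitions G k)"
  proof (cases "k - 1 \<le> q")
    case True
    have "?x \<le> real q / real (k - 1)"
    proof -
      define K where "K = real (k - 1)"
      have "0 < K" unfolding K_def using k by simp
      moreover have "ln (real ?n) \<le> 5 * real q" using le True k by linarith
      ultimately show ?thesis unfolding K_def[symmetric] by (simp add: field_simps)
    qed
    then have "?x ^ (k - 1) \<le> (real q / real (k - 1)) ^ (k - 1)"
      using ln by (intro power_mono) auto
    also have "\<dots> \<le> real (q choose (k - 1))"
      using binomial_ge_n_over_k_pow_k[OF True, where 'a = real] by simp
    also have "\<dots> \<le> real (num_edge_partitions G k)"
      using binomial_le_num_edge_partitions[OF G k(1) q] by simp
    finally show ?thesis .
  next
    case False
    then have "2 * q + 3 \<le> 5 * (k - 1)" by linarith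
    then have "ln (real ?n) \<le> 5 * real (k - 1)" using le by linarith
    then have "?x ^ (k - 1) \<le> 1"
      using ln k by (intro power_le_one) (auto simp: field_simps)
    then show ?thesis using num_edge_partitions_pos[OF G _ k(2)] k by linarith
  qed
  then show ?thesis by (simp only: power_mult_distrib)
qed


section \<open>Partitions into two parts\<close>

text \<open>\<open>ext p\<close> is the largest size of a heavy rooted tree with at most \<open>p\<close> cut positions: branching
  into \<open>d\<close> equal branches costs \<open>d\<close> cut positions and multiplies the size by \<open>d\<close> (after adding
  one edge), and eventually \<open>d = 3\<close> is the best choice.\<close>

fun ext :: "nat \<Rightarrow> nat" where
  "ext p = (if p < 8 then [0, 1, 2, 4, 6, 10, 15, 22] ! p else 3 * ext (p - 3) + 3)"

declare ext.simps [simp del]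

lemma ext_numeral [simp]:
  "ext 0 = 0" "ext (Suc 0) = 1" "ext (Suc (Suc 0)) = 2" "ext (Suc (Suc (Suc 0))) = 4" "ext 2 = 2" "ext 3 = 4" "ext 4 = 6" "ext 5 = 10" "ext 6 = 15"
  "ext 7 = 22" "ext 8 = 33" "ext 9 = 48" "ext 10 = 69"
  by (simp_all add: ext.simps)

lemma ext_add3: "5 \<le> p \<Longrightarrow> ext (p + 3) = 3 * ext p + 3"
  by (subst ext.simps) simp

text \<open>The base cases and the threshold 5 match the table and the recursion of
  \<open>ext\<close>.\<close>

lemma nat_induct3:
  assumes "P 0" "P (Suc 0)" "P 2" "P 3" "P 4" "P 5" "P 6" "P 7" "\<And>p. 5 \<le> p \<Longrightarrow> P p \<Longrightarrow> P (p + 3)"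
  shows "P (p :: nat)"
proof (induction p rule: less_induct)
  case (less p)
  show ?case
  proof (cases "p < 8")
    case True
    then have "p = 0 \<or> p = Suc 0 \<or> p = 2 \<or> p = 3 \<or> p = 4 \<or> p = 5 \<or> p = 6 \<or> p = 7" by linarith
    then show ?thesis using assms by metis
  next
    case False
    then have "P (p - 3)" using less by simp
    then show ?thesis using assms(9)[of "p - 3"] False by simp
  qed
qed

lemma ext_Suc: "ext p + 1 \<le> ext (p + 1)"
proof (induction p rule: nat_induct3)
  case (9 p)
  have "ext (p + 3 + 1) = 3 * ext (p + 1) + 3" using ext_add3[of "p + 1"] 9 by (simp add: ac_simps)
  then show ?case using 9 ext_add3[OF 9(1)] by linarith
qed simp_all

lemma ext_2: "2 * (ext p + 1) \<le> ext (p + 2)"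
proof (induction p rule: nat_induct3)
  case (9 p)
  have "ext (p + 3 + 2) = 3 * ext (p + 2) + 3" using ext_add3[of "p + 2"] 9 by (simp add: ac_simps)
  then show ?case using 9 ext_add3[OF 9(1)] by simp
qed simp_all

lemma ext_3: "3 * (ext p + 1) \<le> ext (p + 3)"
proof (induction p rule: nat_induct3)
  case (9 p)
  then show ?case using ext_add3[of "p + 3"] by simp
qed simp_all

text \<open>For \<open>0 < p < 8\<close> the table in \<open>ext\<close> holds the maxima of the
  left-hand side over \<open>d\<close>. For \<open>d \<ge> 4\<close>, using \<open>d - 2\<close>
  branches that each split in 2 costs the same number of cuts and loses nothing, as
  \<open>d \<le> 2 * (d - 2)\<close>.\<close>

lemma ext_mult: "1 \<le> d \<Longrightarrow> d \<le> p \<Longrightarrow> d * (ext (p - d) + 1) \<le> ext p"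
proof (induction d rule: less_induct)
  case (less d)
  show ?case
  proof (cases "d \<le> 3")
    case True
    then have d: "d = 1 \<or> d = 2 \<or> d = 3" using less.prems by linarith
    obtain r where "p = r + d" using less.prems(2) by (metis le_add_diff_inverse2)
    then show ?thesis using d ext_Suc[of r] ext_2[of r] ext_3[of r] by auto
  next
    case False
    have "d * (ext (p - d) + 1) \<le> (d - 2) * (2 * (ext (p - d) + 1))"
      unfolding mult.assoc[symmetric] using False by (intro mult_right_mono) auto
    also have "\<dots> \<le> (d - 2) * ext (p - (d - 2))"
      using ext_2[of "p - d"] False less.prems by (intro mult_left_mono) (auto simp: Suc_diff_le numeral_2_eq_2)
    also have "\<dots> \<le> (d - 2) * (ext (p - (d - 2)) + 1)" by simp
    also have "\<dots> \<le> ext p" using False less.prems by (intro less.IH) auto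
    finally show ?thesis .
  qed
qed

text \<open>With \<open>d\<close> branches, the first has by heaviness at least the fraction
  \<open>1/d\<close> of the edges, so by \<open>ext_mult\<close> it needs more than
  \<open>p - d\<close> cuts; the partial sums add \<open>d\<close> more.\<close>

lemma card_cuts_gt: "heavy t \<Longrightarrow> ext p < esize t \<Longrightarrow> p < card (cuts t)"
proof (induction t arbitrary: p rule: cuts.induct)
  case (2 x c cs)
  let ?d = "length (c # cs)"
  have card: "card (cuts (Node x (c # cs))) = card (cuts c) + ?d"
    unfolding cuts.simps using cuts_disjoint[of "{1..?d}" c cs] by simp
  show ?case
  proof (cases "p < ?d")
    case False
    have "sum_list (take ?d (branches (c # cs))) \<le> ?d * Suc (esize c)"
      by (rule sum_take_le) (use "2.prems" in auto)
    then have "esize (Node x (c # cs)) \<le> ?d * Suc (esize c)"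
      unfolding esize_Node by simp
    moreover have "?d * (ext (p - ?d) + 1) \<le> ext p" using False by (intro ext_mult) auto
    ultimately have "?d * (ext (p - ?d) + 1) < ?d * Suc (esize c)" using "2.prems"(2) by linarith
    then have "ext (p - ?d) < esize c" unfolding nat_mult_less_cancel_disj by simp
    then have "p - ?d < card (cuts c)" using 2 by simp
    then show ?thesis using card False by linarith
  qed (use card in linarith)
qed simp

text \<open>Root version of \<open>ext_mult\<close>: if only \<open>t\<close> partial sums at the
  root are used, the first branch is known to have more than \<open>1/(2(t + 1))\<close> of the
  edges. For \<open>t \<ge> 3\<close>, \<open>t + 1 \<le> 2 * (t - 1)\<close> reduces the claim to
  \<open>t - 2\<close>.\<close>

lemma ext_root: "1 \<le> l \<Longrightarrow> t \<le> 3 * l \<Longrightarrow> 2 * (t + 1) * (ext (3 * l - t) + 1) \<le> ext (3 * l + 3)"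
proof (induction t rule: less_induct)
  case (less t)
  have e: "ext (3 * l + 3) = 3 * ext (3 * l) + 3"
    using less.prems(1) ext_add3[of "3 * l"] by (cases "l = 1") auto
  show ?case
  proof (cases "t \<le> 2")
    case True
    \<comment> \<open>The extra summands 1 and 2 make both inequalities inductive.\<close>
    have 1: "4 * (ext (3 * l - 1) + 1) + 1 \<le> 3 * ext (3 * l) + 3
      \<and> 6 * (ext (3 * l - 2) + 1) + 2 \<le> 3 * ext (3 * l) + 3"
      using less.prems(1)
    proof (induction l rule: dec_induct)
      case (step m)
      show ?case
      \<comment> \<open>For \<open>m \<le> 2\<close> the argument \<open>3 * m - 2\<close> is below
        5, where \<open>ext_add3\<close> does not apply.\<close>
      proof (cases "m \<le> 2")
        case True
        then have "m = 1 \<or> m = 2" using step by linarith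
        then show ?thesis by auto
      next
        case False
        define u where "u = 3 * m - 2"
        have u: "3 * m - 1 = u + 1" "3 * m = u + 2" "3 * m - 2 = u"
          "3 * Suc m - 2 = u + 3" "3 * Suc m - 1 = u + 1 + 3" "3 * Suc m = u + 2 + 3"
          unfolding u_def using False by simp_all
        have "5 \<le> u" unfolding u_def using False by simp
        then show ?thesis using step.IH ext_add3[of u] ext_add3[of "u + 1"] ext_add3[of "u + 2"]
          unfolding u by (simp add: add.commute)
      qed
    qed simp
    have "t = 0 \<or> t = 1 \<or> t = 2" using True by linarith
    then show ?thesis using 1 e by auto
  next
    case False
    have "2 * (t + 1) * (ext (3 * l - t) + 1) \<le> 2 * (t - 1) * (2 * (ext (3 * l - t) + 1))"
      unfolding mult.assoc[symmetric] using False by (intro mult_right_mono) auto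
    also have "\<dots> \<le> 2 * (t - 1) * ext (3 * l - (t - 2))"
      using ext_2[of "3 * l - t"] False less.prems by (intro mult_left_mono) (auto simp: Suc_diff_le numeral_2_eq_2)
    also have "\<dots> \<le> 2 * (t - 2 + 1) * (ext (3 * l - (t - 2)) + 1)"
      using False by (intro mult_mono) auto
    also have "\<dots> \<le> ext (3 * l + 3)" using False less.prems by (intro less.IH) auto
    finally show ?thesis .
  qed
qed

text \<open>At a centroid, all cuts in the first branch and the first \<open>j\<close> partial sums
  are at most half of the edges, so distinct cuts give distinct pairs. If
  \<open>j \<le> 3 * l\<close>, the first branch is large enough to supply more than
  \<open>3 * l - j\<close> cuts.\<close>

lemma num_edge_partitions_2_ge:
  assumes G: "connected_graph G" and l: "1 \<le> l" and E: "ext (3 * l + 3) \<le> card (edges G)"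
  shows "3 * l + 1 \<le> num_edge_partitions G 2"
proof -
  let ?E = "card (edges G)"
  have E2: "2 * (ext (3 * l) + 1) \<le> ?E" using ext_root[OF l, of 0] E by simp
  obtain t0 where t0: "represents t0 G" "heavy t0"
    using ex_represents[OF G] ex_heavy_represents by metis
  have "esize t0 > 0" using represents_esize[OF t0(1)] E2 by simp
  then have "kids t0 \<noteq> []" by (cases t0) auto
  then obtain x c cs where t: "represents (Node x (c # cs)) G" "heavy (Node x (c # cs))"
      "2 * Suc (esize c) \<le> Suc ?E"
    using ex_centroid[OF t0] by blast
  let ?t = "Node x (c # cs)" and ?b = "Suc (esize c)"
  let ?S = "\<lambda>i. sum_list (take i (branches (c # cs)))"
  have Et: "esize ?t = ?E" using represents_esize[OF t(1)] .
  \<comment> \<open>The largest number of branches of maximal size \<open>?b\<close> that fit into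
    half of the edges.\<close>
  define j where "j = ?E div (2 * ?b)"
  have j: "2 * ?b * j \<le> ?E" unfolding j_def by (rule times_div_less_eq_dividend)
  have j': "?E < 2 * ?b * (j + 1)"
    unfolding j_def using dividend_less_times_div[of "2 * ?b" ?E] by simp
  have "?E \<le> length (c # cs) * ?b"
  proof -
    have "?S (length (c # cs)) \<le> length (c # cs) * ?b"
      by (rule sum_take_le) (use t in auto)
    then show ?thesis unfolding Et[symmetric] esize_Node by simp
  qed
  then have "2 * ?b * j \<le> length (c # cs) * ?b" using j by linarith
  then have "2 * j \<le> length (c # cs)" by (metis mult.assoc mult.commute mult_le_cancel2 zero_less_Suc)
  then have I: "{1..j} \<subseteq> {1..length (c # cs)}" by auto
  define A where "A = cuts c \<union> ?S ` {1..j}"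
  have "card A = card (cuts c) + j" unfolding A_def using cuts_disjoint[OF I] by simp
  moreover have "3 * l + 1 \<le> card (cuts c) + j"
  proof (cases "j \<le> 3 * l")
    case True
    have "2 * (j + 1) * (ext (3 * l - j) + 1) < 2 * (j + 1) * ?b"
      using ext_root[OF l True] E j' by (simp add: ac_simps)
    then have "ext (3 * l - j) < esize c" unfolding nat_mult_less_cancel_disj by simp
    then have "3 * l - j < card (cuts c)" using card_cuts_gt[of c] t(2) by simp
    then show ?thesis using True by linarith
  qed simp
  ultimately have "3 * l + 1 \<le> card A" by simp
  also have "card A \<le> num_edge_partitions G 2"
  proof (rule num_edge_partitions_ge)
    show "inj_on (\<lambda>m. [?E - m, m]) A" by (rule inj_onI) simp
    fix m assume m: "m \<in> A"
    have half: "1 \<le> m \<and> 2 * m \<le> ?E"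
    proof (cases "m \<in> cuts c")
      case True
      then show ?thesis using cuts_le[OF True] t(3) by auto
    next
      case False
      then obtain i where i: "i \<in> {1..j}" "m = ?S i" using m unfolding A_def by auto
      have "m \<le> i * ?b" unfolding i(2) by (rule sum_take_le) (use t in auto)
      also have "\<dots> \<le> j * ?b" using i by (intro mult_right_mono) auto
      finally have "2 * m \<le> ?E" using j by (simp add: ac_simps)
      moreover have "1 \<le> m" using i by (cases i) auto
      ultimately show ?thesis by simp
    qed
    have "m \<in> cuts ?t" using m I unfolding A_def cuts.simps by blast
    moreover have "?E \<in> cuts ?t" using esize_in_cuts[of ?t] Et E2 by simp
    ultimately have "connected_edge_partition G (gaps (?E # [m, 0])) (segments (elist ?t) (?E # [m, 0]))"
      using half connected_edge_partition_cuts[OF G t(1), of "[m, 0]"] unfolding Et by simp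
    then show "length [?E - m, m] = 2 \<and> sorted_wrt (\<ge>) [?E - m, m] \<and>
        (\<forall>m \<in> set [?E - m, m]. m \<ge> 1) \<and> (\<exists>Es. connected_edge_partition G [?E - m, m] Es)"
      using half by auto
  qed
  finally show ?thesis .
qed


section \<open>Trees with distinct labels\<close>

lemma elist_NodeE:
  assumes "e \<in> set (elist (Node y cs))"
  obtains c where "c \<in> set cs" "e = {y, root c} \<or> e \<in> set (elist c)"
  using assms by auto

lemma elist_nonempty: "e \<in> set (elist t) \<Longrightarrow> e \<noteq> {}"
  by (induction t) auto

lemma labs_disjoint:
  "distinct (concat (map labs cs)) \<Longrightarrow> c \<in> set cs \<Longrightarrow> d \<in> set cs \<Longrightarrow> c \<noteq> d \<Longrightarrow>
   set (labs c) \<inter> set (labs d) = {}"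
  by (induction cs) auto

lemma distinct_elist: "distinct (labs t) \<Longrightarrow> distinct (elist t)"
proof (induction t)
  case (Node y cs)
  then show ?case
  proof (induction cs)
    case (Cons c cs)
    have IH: "distinct (elist (Node y cs))" using Cons by simp
    have c: "distinct (elist c)" using Cons.prems by simp
    have y: "{y, root c} \<notin> set (elist c)" using elist_subset_labs[of "{y, root c}" c] Cons.prems(2) by auto
    have "e \<notin> set (elist (Node y cs))" if "e = {y, root c} \<or> e \<in> set (elist c)" for e
    proof -
      have "set (labs c) \<inter> set (labs (Node y cs)) = {}" using Cons.prems(2) by auto
      moreover have "e \<inter> set (labs c) \<noteq> {}"
        using that elist_nonempty elist_subset_labs by fastforce
      ultimately show ?thesis using elist_subset_labs[of e "Node y cs"] by blast
    qed
    then show ?case using IH c y by auto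
  qed simp
qed

text \<open>Distinct labels make the branches vertex-disjoint, so a branch is attached only by its
  top edge.\<close>

lemma edge_into_branch:
  assumes d: "distinct (labs (Node y cs))" and c: "c \<in> set cs"
    and e: "{p, q} \<in> set (elist (Node y cs))" "p \<notin> set (labs c)" "q \<in> set (labs c)"
  shows "p = y \<and> q = root c"
proof -
  obtain d where d': "d \<in> set cs" "{p, q} = {y, root d} \<or> {p, q} \<in> set (elist d)"
    using e(1) by (rule elist_NodeE)
  have "y \<notin> set (labs c)" using d c by auto
  moreover have "set (labs c) \<inter> set (labs d) = {}" if "c \<noteq> d"
    using labs_disjoint[of cs c d] d c d'(1) that by auto
  moreover have "{p, q} \<in> set (elist d) \<Longrightarrow> p \<in> set (labs d) \<and> q \<in> set (labs d)"
    using elist_subset_labs[of "{p, q}" d] by auto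
  ultimately show ?thesis using d'(2) e(2,3) root_labs[of d]
    by (cases "c = d"; auto simp: doubleton_eq_iff)
qed

lemma edge_inside_branch:
  assumes d: "distinct (labs (Node y cs))" and c: "c \<in> set cs"
    and e: "e \<in> set (elist (Node y cs))" "e \<subseteq> set (labs c)"
  shows "e \<in> set (elist c)"
proof -
  obtain d where d': "d \<in> set cs" "e = {y, root d} \<or> e \<in> set (elist d)"
    using e(1) by (rule elist_NodeE)
  have "y \<notin> set (labs c)" using d c by auto
  then have ed: "e \<in> set (elist d)" using d' e(2) by auto
  have "set (labs c) \<inter> set (labs d) = {}" if "c \<noteq> d"
    using labs_disjoint[of cs c d] d c d'(1) that by auto
  then show ?thesis using ed e(2) elist_subset_labs[OF ed] elist_nonempty[OF ed] by blast
qed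

lemma reach_into_branch:
  assumes d: "distinct (labs (Node y cs))" and c: "c \<in> set cs"
    and F: "F \<subseteq> set (elist (Node y cs))" "reach F p q" "p \<notin> set (labs c)" "q \<in> set (labs c)"
  shows "{y, root c} \<in> F"
proof -
  obtain p' q' where "{p', q'} \<in> F" "p' \<notin> set (labs c)" "q' \<in> set (labs c)"
    using reach_exits[OF F(2), of "- set (labs c)"] F by auto
  then show ?thesis using edge_into_branch[OF d c, of p' q'] F(1) by blast
qed

text \<open>If \<open>X\<close> meets the root, it is a union of whole branches; otherwise it lies
  below the top edge of one branch, and the situation repeats there.\<close>

lemma cut_cases:
  assumes d: "distinct (labs (Node y cs))"
    and X: "X \<subseteq> set (elist (Node y cs))" "X \<noteq> {}"
    and conn: "\<forall>u \<in> \<Union>X. \<forall>v \<in> \<Union>X. reach X u v"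
    and hang: "hang y (set (elist (Node y cs)) - X)"
  shows "(\<exists>P. card X = sum_list (branches (filter P cs))) \<or>
    (\<exists>c \<in> set cs. X \<subseteq> set (elist c) \<and> hang (root c) (set (elist c) - X))"
proof -
  let ?Y = "set (elist (Node y cs)) - X"
  have y: "y \<notin> set (labs c)" if "c \<in> set cs" for c using d that by auto
  have vert: "\<exists>u \<in> e. u \<in> set (labs c)" if "e \<in> set (elist c)" for e and c :: "'a rtree"
    using elist_nonempty[OF that] elist_subset_labs[OF that] by auto
  \<comment> \<open>An edge of the rest inside a branch is reached from \<open>y\<close>, hence
    through the top edge of that branch.\<close>
  have Yr: "{y, root c} \<in> ?Y" if "c \<in> set cs" "e \<in> set (elist c)" "e \<notin> X" for c e
  proof -
    have "\<exists>u \<in> e. u \<in> set (labs c)" using vert[OF that(2)] .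
    then obtain u where u: "u \<in> e" "u \<in> set (labs c)" by auto
    have "e \<in> ?Y" using that by auto
    then have "reach ?Y y u" using hang u unfolding hang_def by blast
    then show ?thesis using reach_into_branch[OF d that(1) _ _ y[OF that(1)] u(2)] by blast
  qed
  show ?thesis
  proof (cases "y \<in> \<Union>X")
    case True
    define P where "P c \<longleftrightarrow> {y, root c} \<in> X" for c
    \<comment> \<open>Connectivity puts the top edge of every touched branch into \<open>X\<close>;
      by \<open>Yr\<close>, a top edge in \<open>X\<close> brings its whole branch along.\<close>
    have "X = set (elist (Node y (filter P cs)))"
    proof (intro equalityI subsetI)
      fix e assume e: "e \<in> X"
      then obtain c where c: "c \<in> set cs" "e = {y, root c} \<or> e \<in> set (elist c)"
        using X(1) elist_NodeE by (metis subsetD)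
      have "P c"
      proof (cases "e = {y, root c}")
        case False
        then obtain u where u: "u \<in> e" "u \<in> set (labs c)" using c vert by auto
        then have "reach X y u" using True e conn by blast
        then show ?thesis unfolding P_def using reach_into_branch[OF d c(1) X(1) _ y[OF c(1)] u(2)] by blast
      qed (use e in \<open>simp add: P_def\<close>)
      then show "e \<in> set (elist (Node y (filter P cs)))" using c by auto
    next
      fix e assume "e \<in> set (elist (Node y (filter P cs)))"
      then obtain c where c: "c \<in> set cs" "{y, root c} \<in> X" "e = {y, root c} \<or> e \<in> set (elist c)"
        unfolding P_def by auto
      then show "e \<in> X" using Yr[OF c(1), of e] by auto
    qed
    moreover have "distinct (labs (Node y (filter P cs)))"
      using d by (induction cs) auto
    then have "card (set (elist (Node y (filter P cs)))) = esize (Node y (filter P cs))"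
      using distinct_elist distinct_card by blast
    ultimately have "card X = sum_list (branches (filter P cs))" by (simp only: esize_Node)
    then show ?thesis by blast
  next
    case False
    obtain e where e: "e \<in> X" using X(2) by auto
    then obtain c where c: "c \<in> set cs" "e \<in> set (elist c)"
      using X(1) False elist_NodeE by (metis Union_iff insertI1 subsetD)
    obtain u where u: "u \<in> e" "u \<in> set (labs c)" using vert[OF c(2)] by auto
    have "X \<subseteq> set (elist c)"
    proof
      fix f assume f: "f \<in> X"
      have "f \<subseteq> set (labs c)"
      proof (rule ccontr)
        assume "\<not> f \<subseteq> set (labs c)"
        then obtain v where "v \<in> f" "v \<notin> set (labs c)" by auto
        then have "{y, root c} \<in> X"
          using reach_into_branch[OF d c(1) X(1), of v u] u e f conn by blast
        then show False using False by auto
      qed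
      then show "f \<in> set (elist c)" by (rule edge_inside_branch[OF d c(1) subsetD[OF X(1) f]])
    qed
    moreover have "hang (root c) (set (elist c) - X)"
      unfolding hang_def
    proof
      fix v assume v: "v \<in> \<Union>(set (elist c) - X)"
      then have vc: "v \<in> set (labs c)" using elist_subset_labs by fastforce
      have "v \<in> \<Union>?Y" using v c(1) by auto
      then have "reach ?Y y v" using hang unfolding hang_def by blast
      \<comment> \<open>Induction along the path, with a claim only about vertices inside the
        branch: it can be entered only at \<open>root c\<close>, where the claim is trivial.\<close>
      then show "reach (set (elist c) - X) (root c) v"
        using vc
      proof (induction rule: rtrancl_induct)
        case base
        then show ?case using y[OF c(1)] by simp
      next
        case (step p q)
        then have pq: "{p, q} \<in> ?Y" by auto
        show ?case
        proof (cases "p \<in> set (labs c)")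
          case True
          then have "{p, q} \<in> set (elist c) - X"
            using edge_inside_branch[OF d c(1), of "{p, q}"] pq step.prems by auto
          then show ?thesis using step.IH[OF True] by (auto intro: rtrancl_into_rtrancl)
        next
          case False
          then show ?thesis using edge_into_branch[OF d c(1), of p q] pq step.prems by auto
        qed
      qed
    qed
    ultimately show ?thesis using c(1) by blast
  qed
qed

section \<open>The tree \<open>T(l)\<close>\<close>

fun ttree :: "nat \<Rightarrow> nat list \<Rightarrow> (nat list \<times> nat) rtree" where
  "ttree 0 w = Node (w, 2) [Node (w, 1) [Node (w, 0) []], Node (w, 3) [Node (w, 4) []]]"
| "ttree (Suc l) w = Node (w, 2) [ttree l (0 # w), ttree l (1 # w), ttree l (2 # w)]"

text \<open>A branch is counted with its top edge: at level 0 these are the 4 edges of the glued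
  path and one more.\<close>

fun bsize :: "nat \<Rightarrow> nat" where
  "bsize 0 = 5"
| "bsize (Suc l) = 3 * bsize l + 1"

text \<open>Each level offers unions of one, two or three equal branches. At level 0 there are two
  half-paths of size 2, and a single end edge gives 1.\<close>

fun cut_sizes :: "nat \<Rightarrow> nat set" where
  "cut_sizes 0 = {1, 2, 4}"
| "cut_sizes (Suc l) = {bsize l, 2 * bsize l, 3 * bsize l} \<union> cut_sizes l"

lemma root_ttree [simp]: "root (ttree l w) = (w, 2)"
  by (cases l) auto

lemma esize_ttree: "Suc (esize (ttree l w)) = bsize l"
proof (induction l arbitrary: w)
  case (Suc l)
  then show ?case unfolding ttree.simps esize_Node by simp
qed simp

lemma labs_ttree: "p \<in> set (labs (ttree l w)) \<Longrightarrow> \<exists>u. fst p = u @ w"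
proof (induction l arbitrary: w)
  case (Suc l)
  then consider "p = (w, 2)" | i where "p \<in> set (labs (ttree l (i # w)))" by auto
  then show ?case
  proof cases
    case 2
    then obtain u where "fst p = u @ i # w" using Suc.IH by blast
    then show ?thesis by (intro exI[of _ "u @ [i]"]) simp
  qed simp
qed auto

lemma distinct_ttree: "distinct (labs (ttree l w))"
proof (induction l arbitrary: w)
  case (Suc l)
  have "(w, 2) \<notin> set (labs (ttree l (i # w)))" for i
    using labs_ttree[of "(w, 2)" l "i # w"] by auto
  moreover have "set (labs (ttree l (i # w))) \<inter> set (labs (ttree l (j # w))) = {}" if "i \<noteq> j" for i j
  proof -
    have False if p: "p \<in> set (labs (ttree l (i # w)))" "p \<in> set (labs (ttree l (j # w)))" for p
    proof -
      obtain u u' where "fst p = u @ i # w" "fst p = u' @ j # w"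
        using labs_ttree p by metis
      then have "(u @ [i]) @ w = (u' @ [j]) @ w" by simp
      then show False using \<open>i \<noteq> j\<close> by (simp only: append_same_eq) simp
    qed
    then show ?thesis by blast
  qed
  ultimately show ?case using Suc by (simp add: Int_Un_distrib)
qed simp

text \<open>Since \<open>ttree\<close> prepends letters, the last letter of a word tells under which
  child of the root it lies.\<close>

lemma ternary_words_Suc: "ternary_words (Suc l) = (\<Union>i \<in> {0, 1, 2}. (\<lambda>u. u @ [i]) ` ternary_words l)"
proof (intro equalityI subsetI)
  fix w assume w: "w \<in> ternary_words (Suc l)"
  then obtain u i where "w = u @ [i]" unfolding ternary_words_def by (cases w rule: rev_cases) auto
  then show "w \<in> (\<Union>i \<in> {0, 1, 2}. (\<lambda>u. u @ [i]) ` ternary_words l)"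
    using w unfolding ternary_words_def by auto
qed (auto simp: ternary_words_def)

lemma UN_ternary_words_Suc:
  "(\<Union>m < Suc l. ternary_words m) = insert [] (\<Union>i \<in> {0, 1, 2}. (\<lambda>u. u @ [i]) ` (\<Union>m < l. ternary_words m))"
proof -
  have "{..<Suc l} = insert 0 (Suc ` {..<l})" by (rule lessThan_Suc_eq_insert_0)
  then have "(\<Union>m < Suc l. ternary_words m) = ternary_words 0 \<union> (\<Union>m < l. ternary_words (Suc m))"
    by auto
  also have "ternary_words 0 = {[]}" unfolding ternary_words_def by auto
  finally show ?thesis unfolding ternary_words_Suc by auto
qed

lemma set_elist_ttree:
  "set (elist (ttree l w)) =
    (\<Union>u \<in> (\<Union>m < l. ternary_words m). (\<lambda>i. {(u @ w, 2), (i # u @ w, 2)}) ` {0, 1, 2}) \<union>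
    (\<Union>u \<in> ternary_words l. (\<lambda>j. {(u @ w, j), (u @ w, Suc j)}) ` {..<4})"
proof (induction l arbitrary: w)
  case 0
  have "ternary_words 0 = {[]}" "{..<4} = {0, 1, 2, 3::nat}" unfolding ternary_words_def by auto
  then show ?case by (auto simp: insert_commute numeral_eq_Suc)
next
  case (Suc l)
  show ?case unfolding UN_ternary_words_Suc ternary_words_Suc ttree.simps
    by (simp add: Suc.IH) blast
qed

lemma edges_ternary_path_tree: "edges (ternary_path_tree l) = set (elist (ttree l []))"
  unfolding set_elist_ttree ternary_path_tree_def by auto

text \<open>\<open>cut_cases\<close> either stops with a union of equal branches or descends into
  one child, where the hypotheses hold again.\<close>

lemma card_cut_ttree:
  assumes "X \<subseteq> set (elist (ttree l w))" "X \<noteq> {}"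
    "\<forall>u \<in> \<Union>X. \<forall>v \<in> \<Union>X. reach X u v"
    "hang (w, 2) (set (elist (ttree l w)) - X)"
  shows "card X \<in> cut_sizes l"
  using assms
proof (induction l arbitrary: w)
  case 0
  have pos: "card X \<noteq> 0" using 0 by (metis List.finite_set card_0_eq finite_subset)
  from cut_cases[OF distinct_ttree[of 0 w, unfolded ttree.simps] 0(1-4)[unfolded ttree.simps]]
  show ?case
  proof (elim disjE bexE exE conjE)
    fix P assume "card X = sum_list (branches (filter P
      [Node (w, 1) [Node (w, 0) []], Node (w, 3) [Node (w, 4) []]]))"
    then show ?thesis using pos by (auto split: if_splits)
  next
    fix c assume "c \<in> set [Node (w, 1) [Node (w, 0) []], Node (w, 3) [Node (w, 4) []]]" "X \<subseteq> set (elist c)"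
    then have "card X \<le> 1" using card_mono[of "set (elist c)" X] by auto
    then have "card X = 1" using pos by linarith
    then show ?thesis by simp
  qed
next
  case (Suc l)
  have pos: "card X \<noteq> 0" using Suc.prems by (metis List.finite_set card_0_eq finite_subset)
  from cut_cases[OF distinct_ttree[of "Suc l" w, unfolded ttree.simps] Suc.prems(1-4)[unfolded ttree.simps]]
  show ?case
  proof (elim disjE bexE exE conjE)
    fix P assume "card X = sum_list (branches (filter P [ttree l (0 # w), ttree l (1 # w), ttree l (2 # w)]))"
    then show ?thesis using pos by (auto simp: esize_ttree split: if_splits)
  next
    fix c assume c: "c \<in> set [ttree l (0 # w), ttree l (1 # w), ttree l (2 # w)]"
      "X \<subseteq> set (elist c)" "hang (root c) (set (elist c) - X)"
    then obtain i where "c = ttree l (i # w)" by auto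
    then have "card X \<in> cut_sizes l" using Suc.IH[of "i # w"] Suc.prems c by simp
    then show ?thesis by simp
  qed
qed

section \<open>Upper bound for the partitions of T(l) into two parts\<close>

lemma card_cut_sizes: "finite (cut_sizes l) \<and> card (cut_sizes l) \<le> 3 * l + 3"
proof (induction l)
  case (Suc l)
  have "card (cut_sizes (Suc l)) \<le> card {bsize l, 2 * bsize l, 3 * bsize l} + card (cut_sizes l)"
    unfolding cut_sizes.simps by (rule card_Un_le)
  also have "card {bsize l, 2 * bsize l, 3 * bsize l} \<le> 3"
    using card_insert_le_m1 by (simp add: card_insert_if)
  finally show ?case using Suc by simp
qed simp

text \<open>One part hangs at the root, so the other has a size in \<open>cut_sizes (Suc l)\<close>.
  Size \<open>3 * bsize l\<close> would leave the former empty, and \<open>bsize l\<close> and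
  \<open>2 * bsize l\<close> are complementary, so the top level adds just one pair.\<close>

lemma num_edge_partitions_ternary_path_tree_le:
  "num_edge_partitions (ternary_path_tree (Suc l)) 2 \<le> 3 * Suc l + 1"
proof -
  let ?t = "ttree (Suc l) []" and ?E = "3 * bsize l"
  let ?G = "ternary_path_tree (Suc l)"
  have G: "edges ?G = set (elist ?t)" by (rule edges_ternary_path_tree)
  have E: "card (edges ?G) = ?E"
    unfolding G distinct_card[OF distinct_elist[OF distinct_ttree]]
    using esize_ttree[of "Suc l" "[]"] by (simp del: ttree.simps)
  define f where "f m = (if m \<le> ?E - m then [?E - m, m] else [m, ?E - m])" for m
  have fE: "f (?E - m) = f m" if "m \<le> ?E" for m unfolding f_def using that by auto
  have step: "f (card X) \<in> f ` insert (bsize l) (cut_sizes l)"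
    if XY: "X \<union> Y = edges ?G" "X \<inter> Y = {}" "X \<noteq> {}" "Y \<noteq> {}" "connected_graph (\<Union>X, X)"
      "hang ([], 2) Y" for X Y
  proof -
    have "X \<subseteq> edges ?G" "edges ?G - X = Y" using XY by auto
    then have "card X \<in> cut_sizes (Suc l)"
      using XY unfolding G by (intro card_cut_ttree[where w = "[]"]) (auto simp: connected_graph_def)
    moreover have "card X + card Y = ?E"
      using XY(1,2) E G by (metis List.finite_set card_Un_disjoint finite_Un)
    moreover have "card Y \<noteq> 0" using XY(1,4) G by (metis List.finite_set card_0_eq finite_Un)
    ultimately have "card X = bsize l \<or> card X = 2 * bsize l \<or> card X \<in> cut_sizes l" by auto
    moreover have "f (2 * bsize l) = f (bsize l)" using fE[of "bsize l"] by simp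
    ultimately show ?thesis by auto
  qed
  have "{ms :: nat list. length ms = 2 \<and> sorted_wrt (\<ge>) ms \<and> (\<forall>m \<in> set ms. m \<ge> 1) \<and>
     (\<exists>Es. connected_edge_partition ?G ms Es)} \<subseteq> f ` insert (bsize l) (cut_sizes l)"
  proof
    fix ms :: "nat list"
    assume "ms \<in> {ms. length ms = 2 \<and> sorted_wrt (\<ge>) ms \<and> (\<forall>m \<in> set ms. m \<ge> 1) \<and>
     (\<exists>Es. connected_edge_partition ?G ms Es)}"
    then obtain Es where ms: "length ms = 2" "sorted_wrt (\<ge>) ms" "\<forall>m \<in> set ms. m \<ge> 1"
      and Es: "connected_edge_partition ?G ms Es" by auto
    obtain a b where ab: "ms = [a, b]" using ms(1) by (auto simp: length_Suc_conv numeral_2_eq_2)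
    have "length Es = 2" using Es ms(1) unfolding connected_edge_partition_def by simp
    then obtain X Y where XY: "Es = [X, Y]" by (auto simp: length_Suc_conv numeral_2_eq_2)
    have Un: "X \<union> Y = edges ?G" "X \<inter> Y = {}" and sz: "a + b = ?E" "card X = a" "card Y = b"
      and conn: "connected_graph (\<Union>X, X)" "connected_graph (\<Union>Y, Y)"
      using Es E unfolding connected_edge_partition_def XY ab
      by (auto simp: less_Suc_eq all_conj_distrib)
    have ne: "X \<noteq> {}" "Y \<noteq> {}" using sz ms(3) ab by auto
    have "{([], 2), ([0], 2)} \<in> set (elist ?t)" by simp
    then have "([], 2) \<in> \<Union>X \<or> ([], 2) \<in> \<Union>Y" using Un(1) G by blast
    then have "hang ([], 2) X \<or> hang ([], 2) Y"
      using conn unfolding connected_graph_def hang_def by auto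
    then have "f a \<in> f ` insert (bsize l) (cut_sizes l) \<or> f b \<in> f ` insert (bsize l) (cut_sizes l)"
      using step[of X Y] step[of Y X] Un ne conn sz by (auto simp: Un_commute Int_commute)
    moreover have "f a = ms" "f b = ms" using sz(1) ms(2) unfolding ab f_def by auto
    ultimately show "ms \<in> f ` insert (bsize l) (cut_sizes l)" by auto
  qed
  then have "num_edge_partitions ?G 2 \<le> card (f ` insert (bsize l) (cut_sizes l))"
    unfolding num_edge_partitions_def using card_cut_sizes by (intro card_mono) auto
  also have "\<dots> \<le> card (insert (bsize l) (cut_sizes l))"
    using card_cut_sizes by (intro card_image_le) auto
  also have "\<dots> \<le> 3 * Suc l + 1"
    using card_cut_sizes[of l] card_insert_le_m1[of "3 * l + 4" "cut_sizes l" "bsize l"] by simp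
  finally show ?thesis .
qed

text \<open>This matches the edge threshold of \<open>num_edge_partitions_2_ge\<close> with the
  vertex number of T(l): with \<open>l\<close>, both sides pass from \<open>v\<close> to
  \<open>3 * v + 1\<close>.\<close>

lemma ext_eq: "1 \<le> l \<Longrightarrow> ext (3 * l + 3) + 1 = 4 * 3 ^ l + (\<Sum>i = 0..l. 3 ^ i)"
proof (induction l rule: dec_induct)
  case (step m)
  have "(\<Sum>i = 0..Suc m. 3 ^ i) = 1 + 3 * (\<Sum>i = 0..m. 3 ^ i :: nat)"
    by (simp only: sum.atLeast0_atMost_Suc_shift sum_distrib_left power_Suc power_0 comp_def)
  then show ?case using step ext_add3[of "3 * m + 3"] by (simp add: add.commute)
qed simp

theorem theorem3:
  "(\<forall>k \<ge> 2. \<exists>c > (0 :: real). \<forall>G :: 'a ugraph.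
      connected_graph G \<and> card (edges G) \<ge> k \<longrightarrow>
      real (num_edge_partitions G k) \<ge> c * ln (real (card (verts G))) ^ (k - 1)) \<and>
   (\<forall>l \<ge> 1. \<forall>T :: 'a ugraph.
      is_tree T \<and> card (verts T) = 4 * 3 ^ l + (\<Sum>i = 0..l. 3 ^ i) \<longrightarrow>
      num_edge_partitions T 2 \<ge> num_edge_partitions (ternary_path_tree l) 2)"
proof (intro conjI allI impI)
  fix k :: nat assume k: "k \<ge> 2"
  show "\<exists>c > (0 :: real). \<forall>G :: 'a ugraph. connected_graph G \<and> card (edges G) \<ge> k \<longrightarrow>
      real (num_edge_partitions G k) \<ge> c * ln (real (card (verts G))) ^ (k - 1)"
    using k num_edge_partitions_log
    by (intro exI[of _ "(1 / (5 * real (k - 1))) ^ (k - 1)"]) auto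
next
  fix l :: nat and T :: "'a ugraph"
  assume l: "l \<ge> 1" and T: "is_tree T \<and> card (verts T) = 4 * 3 ^ l + (\<Sum>i = 0..l. 3 ^ i)"
  then have G: "connected_graph T" unfolding is_tree_def by simp
  have "ext (3 * l + 3) \<le> card (edges T)" using card_verts_le[OF G] T ext_eq[OF l] by simp
  from num_edge_partitions_2_ge[OF G l this]
  show "num_edge_partitions (ternary_path_tree l) 2 \<le> num_edge_partitions T 2"
    using l num_edge_partitions_ternary_path_tree_le[of "l - 1"] by simp
qed

end
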